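(* Let $m,s\in\mathbb{N}_0$ and let $\kappa\in\mathbb{R}$ with $|\kappa|>0$. Define $c_0=1$ and \[ c_j=\prod_{k=0}^{j-1}\left(-\frac{4(s-k)(m+s-k)}{\kappa^2}\right),\qquad j>0 . \] Then \[ I_1(m+1+2s,m,\kappa,t)=\frac{1}{\kappa}\,t^{m+1}J_{m+1,\kappa}(t)\sum_{j=0}^{s}c_{s-j}t^{2j}+\frac{1}{\kappa^2}\,t^{m}J_{m,\kappa}(t)\sum_{j=1}^{s}c_{s-j}\,2j\,t^{2j}. \]
   Context: $\mathbb{N}_0=\{0,1,2,\dots\}$. $J_m$ is the Bessel function of the first kind of integer order $m$, and $J_{m,\kappa}(t):=J_m(\kappa t)$ for real $t$. $I_1(n,m,\kappa,t):=\int t^nJ_m(\kappa t)\,dt$ denotes the indefinite integral (an antiderivative in $t$ of $t^nJ_m(\kappa t)$); identities between indefinite integrals are understood up to an additive constant. Empty sums are $0$. *)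

theory Defs
  imports Complex_Main
begin

definition bessel_J :: "nat \<Rightarrow> real \<Rightarrow> real" where
  "bessel_J m x = (\<Sum>k. (-1) ^ k / (fact k * fact (m + k)) * (x / 2) ^ (2 * k + m))"

(* The indefinite integral is the set of all antiderivatives on the real line, so that an
   identity up to an additive constant becomes an equality of sets. *)
definition indefinite_integral :: "(real \<Rightarrow> real) \<Rightarrow> (real \<Rightarrow> real) set" where
  "indefinite_integral f = {F. \<forall>t. (F has_real_derivative f t) (at t)}"

definition I1 :: "nat \<Rightarrow> nat \<Rightarrow> real \<Rightarrow> (real \<Rightarrow> real) set" where
  "I1 n m \<kappa> = indefinite_integral (\<lambda>t. t ^ n * bessel_J m (\<kappa> * t))"

(* The empty product gives the value 1 at j = 0. *)
definition c :: "nat \<Rightarrow> nat \<Rightarrow> real \<Rightarrow> nat \<Rightarrow> real" where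
  "c m s \<kappa> j =
     (\<Prod>k<j. - (4 * (real s - real k) * (real m + real s - real k) / \<kappa>\<^sup>2))"

end

theory Submission
  imports Defs
begin

text \<open>Write \<open>u j t = t ^ (m + 1 + 2 * j) * J\<^sub>m(\<kappa>t)\<close>. The two differentiation rules for Bessel
  functions, \<open>(x\<^sup>n J\<^sub>n)' = x\<^sup>n J\<^bsub>n-1\<^esub>\<close> for \<open>n \<ge> 1\<close> and \<open>x J\<^sub>n' = n J\<^sub>n - x J\<^bsub>n+1\<^esub>\<close>, show that the part
  of the right-hand side multiplied by \<open>c (s - j)\<close> has the derivative
  \<open>u j + 4 j (m + j) / \<kappa>\<^sup>2 * u (j - 1)\<close>: the contributions containing \<open>J\<^bsub>m+1\<^esub>\<close> cancel
  (\<open>bessel_term_derivative\<close>). The coefficients satisfy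
  \<open>c (s - j) * 4 j (m + j) / \<kappa>\<^sup>2 = - c (s - (j - 1))\<close> for \<open>j \<ge> 1\<close> (\<open>c_step\<close>), so the weighted sum of these
  derivatives telescopes (\<open>c_telescope\<close>), and only \<open>c 0 * u s = u s\<close>, the integrand, remains.
  Antiderivatives on the whole line differ by constants, which gives the equality of sets.

  Both differentiation rules come from the factorization \<open>J\<^sub>n(x) = (x/2)\<^sup>n \<Phi>\<^sub>n(x\<^sup>2/4)\<close> with
  \<open>\<Phi>\<^sub>n\<close> an everywhere convergent power series satisfying \<open>\<Phi>\<^sub>n' = - \<Phi>\<^bsub>n+1\<^esub>\<close> and
  \<open>\<Phi>\<^sub>n(y) = (n + 1) \<Phi>\<^bsub>n+1\<^esub>(y) - y \<Phi>\<^bsub>n+2\<^esub>(y)\<close>. Working with \<open>\<Phi>\<close> avoids division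
  by \<open>x\<close>, so the point \<open>0\<close> needs no separate treatment.\<close>

section \<open>The entire factor of the Bessel function\<close>

definition bessel_coeff :: "nat \<Rightarrow> nat \<Rightarrow> real" where
  "bessel_coeff m k = (-1) ^ k / (fact k * fact (m + k))"

definition bessel_entire :: "nat \<Rightarrow> real \<Rightarrow> real" where
  "bessel_entire m y = (\<Sum>k. bessel_coeff m k * y ^ k)"

lemma summable_bessel_coeff: "summable (\<lambda>k. bessel_coeff m k * y ^ k)"
proof (rule summable_comparison_test')
  show "summable (\<lambda>k. \<bar>y\<bar> ^ k / fact k)"
    using summable_exp[of "\<bar>y\<bar>"] by (simp add: divide_inverse mult.commute)
  show "norm (bessel_coeff m k * y ^ k) \<le> \<bar>y\<bar> ^ k / fact k" if "k \<ge> 0" for k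
  proof -
    have "norm (bessel_coeff m k * y ^ k) = \<bar>y\<bar> ^ k / fact k / fact (m + k)"
      by (simp add: bessel_coeff_def abs_mult power_abs)
    also have "\<dots> \<le> \<bar>y\<bar> ^ k / fact k / 1"
      by (intro divide_left_mono) (auto simp: fact_ge_1)
    finally show ?thesis by simp
  qed
qed

lemma bessel_J_eq_entire: "bessel_J m x = (x / 2) ^ m * bessel_entire m ((x / 2)\<^sup>2)"
proof -
  have "bessel_coeff m k * (x / 2) ^ (2 * k + m)
      = (x / 2) ^ m * (bessel_coeff m k * ((x / 2)\<^sup>2) ^ k)" for k
    by (simp only: power_add power_mult mult.assoc mult.left_commute mult.commute[of _ "(x / 2) ^ m"])
  then show ?thesis
    unfolding bessel_J_def bessel_entire_def bessel_coeff_def[symmetric]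
    by (simp only: suminf_mult[OF summable_bessel_coeff])
qed

lemma diffs_bessel_coeff: "diffs (bessel_coeff m) k = - bessel_coeff (Suc m) k"
  by (simp add: diffs_def bessel_coeff_def field_simps del: of_nat_Suc)

lemma bessel_entire_has_derivative:
  "(bessel_entire m has_real_derivative - bessel_entire (Suc m) y) (at y)"
proof -
  have "((\<lambda>y. \<Sum>k. bessel_coeff m k * y ^ k) has_real_derivative
          (\<Sum>k. diffs (bessel_coeff m) k * y ^ k)) (at y)"
    by (rule termdiffs_strong_converges_everywhere) (rule summable_bessel_coeff)
  then show ?thesis
    by (simp add: bessel_entire_def[abs_def] diffs_bessel_coeff
        suminf_minus[OF summable_bessel_coeff])
qed

text \<open>Up to the sign \<open>(-1)\<^sup>k\<close>, the coefficient of \<open>y\<^sup>k\<close> on the left is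
  \<open>1 / (k! (m + k)!) = (m + 1 + k) / (k! (m + 1 + k)!)\<close>. The part \<open>m + 1\<close> of the numerator gives the
  first term on the right; the part \<open>k\<close> cancels against \<open>k!\<close>, and an index shift turns the
  resulting series into the second term.\<close>

lemma bessel_entire_recurrence:
  "bessel_entire m y = (real m + 1) * bessel_entire (Suc m) y - y * bessel_entire (Suc (Suc m)) y"
proof -
  let ?g = "\<lambda>k. real k * bessel_coeff (Suc m) k * y ^ k"
  have shift: "?g (Suc k) = - y * (bessel_coeff (Suc (Suc m)) k * y ^ k)" for k
    using diffs_bessel_coeff[of "Suc m" k] by (simp add: diffs_def algebra_simps)
  have "(\<lambda>k. ?g (Suc k)) sums (- y * bessel_entire (Suc (Suc m)) y)"
    unfolding shift bessel_entire_def
    by (intro sums_mult summable_sums summable_bessel_coeff)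
  then have g: "?g sums (- y * bessel_entire (Suc (Suc m)) y)"
    by (subst (asm) sums_Suc_iff) simp
  have "(\<lambda>k. (real m + 1) * (bessel_coeff (Suc m) k * y ^ k) + ?g k) sums
          ((real m + 1) * bessel_entire (Suc m) y + - y * bessel_entire (Suc (Suc m)) y)"
    unfolding bessel_entire_def[of "Suc m"]
    by (intro sums_add sums_mult summable_sums summable_bessel_coeff g)
  moreover have "(real m + 1) * (bessel_coeff (Suc m) k * y ^ k) + ?g k = bessel_coeff m k * y ^ k" for k
  proof -
    have "bessel_coeff m k = (real m + 1 + real k) * bessel_coeff (Suc m) k"
      by (simp add: bessel_coeff_def divide_simps)
    then show ?thesis by (simp add: algebra_simps)
  qed
  ultimately show ?thesis
    by (simp add: bessel_entire_def sums_iff)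
qed

section \<open>Differentiation rules for Bessel functions\<close>

text \<open>The derivative is kept implicit: solving \<open>x * D = \<dots>\<close> for \<open>D\<close> would fail at \<open>x = 0\<close>, whereas
  the product \<open>x * D\<close> is all that is used below.\<close>

lemma bessel_J_has_derivative:
  obtains D where "(bessel_J m has_real_derivative D) (at x)"
    and "x * D = real m * bessel_J m x - x * bessel_J (m + 1) x"
proof
  let ?D = "real m * (x / 2) ^ (m - 1) / 2 * bessel_entire m ((x / 2)\<^sup>2)
            - (x / 2) ^ m * (x / 2) * bessel_entire (Suc m) ((x / 2)\<^sup>2)"
  have "((\<lambda>x. bessel_entire m ((x / 2)\<^sup>2)) has_real_derivative
          - bessel_entire (Suc m) ((x / 2)\<^sup>2) * (x / 2)) (at x)"
    by (rule DERIV_chain2[OF bessel_entire_has_derivative])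
       (auto intro!: derivative_eq_intros)
  then show "(bessel_J m has_real_derivative ?D) (at x)"
    unfolding bessel_J_eq_entire[abs_def]
    by (auto intro!: derivative_eq_intros simp: algebra_simps)
  show "x * ?D = real m * bessel_J m x - x * bessel_J (m + 1) x"
    by (cases m) (simp_all add: bessel_J_eq_entire field_simps)
qed

lemma bessel_J_recurrence:
  "x * bessel_J m x + x * bessel_J (m + 2) x = 2 * (real m + 1) * bessel_J (m + 1) x"
proof -
  define h where "h = x / 2"
  have "x = 2 * h" by (simp add: h_def)
  then show ?thesis
    unfolding bessel_J_eq_entire
    by (subst bessel_entire_recurrence[of m]) (simp add: power2_eq_square algebra_simps)
qed

lemma power_times_bessel_J_has_derivative:
  "((\<lambda>x. x ^ (m + 1) * bessel_J (m + 1) x) has_real_derivative x ^ (m + 1) * bessel_J m x) (at x)"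
proof -
  obtain D where D: "(bessel_J (m + 1) has_real_derivative D) (at x)"
    and xD: "x * D = real (m + 1) * bessel_J (m + 1) x - x * bessel_J (m + 1 + 1) x"
    by (rule bessel_J_has_derivative)
  have "((\<lambda>x. x ^ (m + 1) * bessel_J (m + 1) x) has_real_derivative
          x ^ m * (real (m + 1) * bessel_J (m + 1) x + x * D)) (at x)"
    using DERIV_mult[OF DERIV_pow[of "m + 1"] D] by (simp add: algebra_simps)
  moreover have "real (m + 1) * bessel_J (m + 1) x + x * D = x * bessel_J m x"
    using xD bessel_J_recurrence[of x m] by (simp add: algebra_simps)
  ultimately show ?thesis by (simp add: mult_ac)
qed

section \<open>The telescoping antiderivative\<close>

text \<open>Differentiating \<open>t ^ (2 * j)\<close> in the first summand leaves
  \<open>2 j / \<kappa> * t ^ (m + 2 * j) * J\<^bsub>m+1\<^esub>(\<kappa>t)\<close>. The second summand is chosen to remove it: by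
  \<open>x J\<^sub>m' = m J\<^sub>m - x J\<^bsub>m+1\<^esub>\<close> its derivative contains the negative of that term, and otherwise
  only \<open>J\<^sub>m\<close>. For \<open>j = 0\<close> the truncated exponent is harmless, as its coefficient vanishes.\<close>

lemma bessel_term_derivative:
  fixes \<kappa> :: real
  assumes "\<kappa> \<noteq> 0"
  shows "((\<lambda>t. 1 / \<kappa> * t ^ (m + 1) * bessel_J (m + 1) (\<kappa> * t) * t ^ (2 * j)
             + 1 / \<kappa>\<^sup>2 * t ^ m * bessel_J m (\<kappa> * t) * (2 * real j * t ^ (2 * j)))
          has_real_derivative
            t ^ (m + 1 + 2 * j) * bessel_J m (\<kappa> * t)
            + 4 * real j * (real m + real j) / \<kappa>\<^sup>2
              * (t ^ (m + 1 + 2 * (j - 1)) * bessel_J m (\<kappa> * t))) (at t)"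
proof -
  have "((\<lambda>t. (\<kappa> * t) ^ (m + 1) * bessel_J (m + 1) (\<kappa> * t)) has_real_derivative
          (\<kappa> * t) ^ (m + 1) * bessel_J m (\<kappa> * t) * \<kappa>) (at t)"
    by (rule DERIV_chain2[OF power_times_bessel_J_has_derivative])
       (auto intro!: derivative_eq_intros)
  from DERIV_cmult[OF this, of "1 / \<kappa> ^ (m + 2)"]
  have A: "((\<lambda>t. 1 / \<kappa> * t ^ (m + 1) * bessel_J (m + 1) (\<kappa> * t)) has_real_derivative
          t ^ (m + 1) * bessel_J m (\<kappa> * t)) (at t)"
    using assms by (simp add: power_mult_distrib field_simps)
  obtain D where D: "(bessel_J m has_real_derivative D) (at (\<kappa> * t))"
    and xD: "\<kappa> * t * D = real m * bessel_J m (\<kappa> * t) - \<kappa> * t * bessel_J (m + 1) (\<kappa> * t)"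
    by (rule bessel_J_has_derivative)
  have J: "((\<lambda>t. bessel_J m (\<kappa> * t)) has_real_derivative D * \<kappa>) (at t)"
    by (rule DERIV_chain2[where f = "bessel_J m" and g = "\<lambda>t. \<kappa> * t", OF D]) (auto intro!: derivative_eq_intros)
  show ?thesis
  proof (cases j)
    case 0
    then show ?thesis using A by simp
  next
    case (Suc i)
    have p: "((\<lambda>t. t ^ (2 * j)) has_real_derivative 2 * real j * t ^ (2 * i + 1)) (at t)"
      using DERIV_pow[of "2 * j" t] Suc by simp
    have q: "((\<lambda>t. t ^ m * t ^ (2 * j)) has_real_derivative
        (real m + 2 * real j) * t ^ (m + 2 * i + 1)) (at t)"
    proof -
      have "((\<lambda>t. t ^ (m + 2 * j)) has_real_derivative
          (real m + 2 * real j) * t ^ (m + 2 * i + 1)) (at t)"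
        using DERIV_pow[of "m + 2 * j" t] Suc by (simp add: add_ac)
      then show ?thesis by (simp add: power_add)
    qed
    have B: "((\<lambda>t. 2 * real j / \<kappa>\<^sup>2 * (t ^ m * t ^ (2 * j) * bessel_J m (\<kappa> * t)))
        has_real_derivative 2 * real j / \<kappa>\<^sup>2 *
          ((real m + 2 * real j) * t ^ (m + 2 * i + 1) * bessel_J m (\<kappa> * t)
            + D * \<kappa> * (t ^ m * t ^ (2 * j)))) (at t)"
      by (intro DERIV_cmult DERIV_mult q J)
    have "t ^ m * t ^ (2 * j) = t ^ (m + 2 * i + 1) * t"
      using Suc by (simp add: power_add)
    then have "D * \<kappa> * (t ^ m * t ^ (2 * j)) = t ^ (m + 2 * i + 1) * (\<kappa> * t * D)"
      by (simp add: mult_ac)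
    then have val: "D * \<kappa> * (t ^ m * t ^ (2 * j)) = t ^ (m + 2 * i + 1) *
        (real m * bessel_J m (\<kappa> * t) - \<kappa> * t * bessel_J (m + 1) (\<kappa> * t))"
      by (simp only: xD)
    let ?A' = "t ^ (m + 1) * bessel_J m (\<kappa> * t) * t ^ (2 * j)
        + 2 * real j * t ^ (2 * i + 1) * (1 / \<kappa> * t ^ (m + 1) * bessel_J (m + 1) (\<kappa> * t))"
    let ?B' = "2 * real j / \<kappa>\<^sup>2 *
          ((real m + 2 * real j) * t ^ (m + 2 * i + 1) * bessel_J m (\<kappa> * t)
            + D * \<kappa> * (t ^ m * t ^ (2 * j)))"
    have "?A' + ?B' = t ^ (m + 1 + 2 * j) * bessel_J m (\<kappa> * t)
            + 4 * real j * (real m + real j) / \<kappa>\<^sup>2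
              * (t ^ (m + 1 + 2 * (j - 1)) * bessel_J m (\<kappa> * t))"
      unfolding val using Suc assms
      by (simp add: power_add field_simps power2_eq_square)
    then show ?thesis
      using DERIV_add[OF DERIV_mult[OF A p] B] by (simp add: mult_ac)
  qed
qed

lemma c_step:
  assumes "Suc i \<le> s"
  shows "c m s \<kappa> (s - Suc i) * (4 * real (Suc i) * (real m + real (Suc i)) / \<kappa>\<^sup>2) = - c m s \<kappa> (s - i)"
proof -
  have "s - i = Suc (s - Suc i)" using assms by simp
  moreover have "real s - real (s - Suc i) = real (Suc i)"
    using assms by (simp add: of_nat_diff)
  ultimately show ?thesis
    by (simp add: c_def add_diff_eq[symmetric] mult_ac del: of_nat_Suc)
qed

lemma c_telescope:
  assumes "n \<le> s"
  shows "(\<Sum>j=0..n. c m s \<kappa> (s - j) * (u j + 4 * real j * (real m + real j) / \<kappa>\<^sup>2 * u (j - 1)))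
          = c m s \<kappa> (s - n) * u n"
  using assms
proof (induction n)
  case 0
  then show ?case by simp
next
  case (Suc n)
  have "c m s \<kappa> (s - Suc n) * (4 * real (Suc n) * (real m + real (Suc n)) / \<kappa>\<^sup>2 * u n)
          = - c m s \<kappa> (s - n) * u n"
    using c_step[OF Suc.prems, of m \<kappa>] by (metis mult.assoc)
  then show ?case
    using Suc by (simp add: distrib_left del: of_nat_Suc)
qed

lemma indefinite_integral_eq_translates:
  assumes "\<And>t. (G has_real_derivative f t) (at t)"
  shows "indefinite_integral f = {F. \<exists>C. \<forall>t. F t = G t + C}"
  unfolding indefinite_integral_def
proof (intro equalityI subsetI CollectI)
  fix F assume "F \<in> {F. \<forall>t. (F has_real_derivative f t) (at t)}"
  then have "((\<lambda>t. F t - G t) has_real_derivative 0) (at t)" for t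
    using DERIV_diff[OF _ assms, of F "f t" t] by simp
  then have "F t - G t = F 0 - G 0" for t
    by (rule DERIV_isconst_all[rule_format])
  then show "\<exists>C. \<forall>t. F t = G t + C"
    by (intro exI[of _ "F 0 - G 0"]) (simp add: algebra_simps)
next
  fix F assume "F \<in> {F. \<exists>C. \<forall>t. F t = G t + C}"
  then obtain C where "F = (\<lambda>t. G t + C)" by auto
  then show "\<forall>t. (F has_real_derivative f t) (at t)"
    using DERIV_add[OF assms DERIV_const] by simp
qed

theorem proposition2p5:
  fixes m s :: nat and \<kappa> :: real
  assumes "\<bar>\<kappa>\<bar> > 0"
  shows "I1 (m + 1 + 2 * s) m \<kappa> =
    {F. \<exists>C. \<forall>t. F t =
        1 / \<kappa> * t ^ (m + 1) * bessel_J (m + 1) (\<kappa> * t)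
          * (\<Sum>j=0..s. c m s \<kappa> (s - j) * t ^ (2 * j))
      + 1 / \<kappa>\<^sup>2 * t ^ m * bessel_J m (\<kappa> * t)
          * (\<Sum>j=1..s. c m s \<kappa> (s - j) * (2 * real j) * t ^ (2 * j))
      + C}"
proof -
  let ?A = "\<lambda>t. 1 / \<kappa> * t ^ (m + 1) * bessel_J (m + 1) (\<kappa> * t)"
  let ?B = "\<lambda>t. 1 / \<kappa>\<^sup>2 * t ^ m * bessel_J m (\<kappa> * t)"
  let ?u = "\<lambda>j t. t ^ (m + 1 + 2 * j) * bessel_J m (\<kappa> * t)"
  let ?G = "\<lambda>t. ?A t * (\<Sum>j=0..s. c m s \<kappa> (s - j) * t ^ (2 * j))
                 + ?B t * (\<Sum>j=1..s. c m s \<kappa> (s - j) * (2 * real j) * t ^ (2 * j))"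
  let ?H = "\<lambda>t. \<Sum>j=0..s. c m s \<kappa> (s - j) * (?A t * t ^ (2 * j) + ?B t * (2 * real j * t ^ (2 * j)))"
  \<comment> \<open>The \<open>j = 0\<close> term vanishes; with it both sums run over the same range and combine termwise.\<close>
  have from0: "(\<Sum>j=1..s. c m s \<kappa> (s - j) * (2 * real j) * t ^ (2 * j))
      = (\<Sum>j=0..s. c m s \<kappa> (s - j) * (2 * real j) * t ^ (2 * j))" for t
    by (rule sum.mono_neutral_left) auto
  have GH: "?G = ?H"
    unfolding from0 sum_distrib_left sum.distrib[symmetric]
    by (intro ext sum.cong refl) (simp only: distrib_left mult_ac)
  have "(?H has_real_derivative (\<Sum>j=0..s. c m s \<kappa> (s - j) *
      (?u j t + 4 * real j * (real m + real j) / \<kappa>\<^sup>2 * ?u (j - 1) t))) (at t)" for t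
    using assms by (intro DERIV_sum DERIV_cmult bessel_term_derivative) simp
  moreover have "(\<Sum>j=0..s. c m s \<kappa> (s - j) *
      (?u j t + 4 * real j * (real m + real j) / \<kappa>\<^sup>2 * ?u (j - 1) t)) = ?u s t" for t
    using c_telescope[of s s m \<kappa> "\<lambda>j. ?u j t"] by (simp add: c_def)
  ultimately have "(?G has_real_derivative ?u s t) (at t)" for t
    unfolding GH by simp
  then show ?thesis
    unfolding I1_def using indefinite_integral_eq_translates[of ?G "?u s"] by simp
qed

end
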